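(* Let $C=(c_1,\dots,c_n)\in\mathrm{Mat}_{m\times n}(\mathbb{Z})$ have nonzero columns. For $q\in\mathbb{Z}_{>0}$ and $J\subseteq\{1,\dots,n\}$, let $H_{j,q}=\{x\in\mathbb{Z}_q^m: x[c_j]_q=[0]_q\}$ and $H_{J,q}=\bigcap_{j\in J}H_{j,q}$. For each nonempty $J$, let $C_J$ be the submatrix of $C$ formed by the columns indexed by $J$, and let $e(J)$ be its largest elementary divisor. Put $$\rho_0=\operatorname{lcm}\{e(J):1\le|J|\le\min\{m,n\}\},\qquad q_0=\max_{\emptyset\ne J\subseteq\{1,\dots,n\}}\ \min_{S_J}\ \max\{|u|: u \text{ is an entry of } S_JC \text{ or of } C\},$$ where for each $J$ the minimum is over all unimodular $S_J\in\mathrm{Mat}_{m\times m}(\mathbb{Z})$ for which there is a unimodular $T_J$ with $S_JC_JT_J$ equal to the Smith normal form of $C_J$. Let $J$ be any nonempty subset of $\{1,\dots,n\}$, and let $q,q'\in\mathbb{Z}_{>0}$ satisfy $q,q'>q_0$ and $\gcd\{\rho_0,q\}=\gcd\{\rho_0,q'\}$. Then for every $j\in\{1,\dots,n\}$: $H_{j,q}\supseteq H_{J,q}$ if and only if $H_{j,q'}\supseteq H_{J,q'}$.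
   Context: $\mathbb{Z}_q=\mathbb{Z}/q\mathbb{Z}$; $[c_j]_q$ is the reduction of $c_j$ mod $q$ and $x$ is a row vector. The Smith normal form of an integer matrix $G\in\mathrm{Mat}_{m\times k}(\mathbb{Z})$ of rank $\ell$ is $SGT=\begin{pmatrix}\mathrm{diag}(e_1,\dots,e_\ell)&O\\O&O\end{pmatrix}$ with $S,T$ unimodular and $e_1|\cdots|e_\ell$ positive integers (the elementary divisors); the largest elementary divisor is $e_\ell$. *)

theory Defs
  imports
    "Jordan_Normal_Form.Determinant"
    "Jordan_Normal_Form.DL_Submatrix"
    "HOL-Number_Theory.Residues"
begin

text \<open>Rows and columns are indexed from 0, so \<open>{1,\<dots>,n}\<close> becomes \<open>{..<n}\<close>.\<close>

definition unimodular :: "nat \<Rightarrow> int mat \<Rightarrow> bool" where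
  "unimodular n U \<longleftrightarrow> U \<in> carrier_mat n n \<and> \<bar>det U\<bar> = 1"

text \<open>The rank is not mentioned separately: if \<open>S * G * T\<close> has the shape below with \<open>S\<close> and \<open>T\<close>
  unimodular, then \<open>length es\<close> is the rank of \<open>G\<close>.\<close>

definition smith_form_mat :: "nat \<Rightarrow> nat \<Rightarrow> int list \<Rightarrow> int mat" where
  "smith_form_mat m k es = mat m k (\<lambda>(i, j). if i = j \<and> i < length es then es ! i else 0)"

definition smith_transform :: "int mat \<Rightarrow> int mat \<Rightarrow> int mat \<Rightarrow> int list \<Rightarrow> bool" where
  "smith_transform G S T es \<longleftrightarrow>
     unimodular (dim_row G) S \<and> unimodular (dim_col G) T \<and>
     length es \<le> min (dim_row G) (dim_col G) \<and>
     (\<forall>e\<in>set es. 0 < e) \<and> sorted_wrt (dvd) es \<and>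
     S * G * T = smith_form_mat (dim_row G) (dim_col G) es"

text \<open>Meaningful only for nonzero \<open>G\<close>; the zero matrix has no elementary divisors.\<close>

definition largest_elementary_divisor :: "int mat \<Rightarrow> int" where
  "largest_elementary_divisor G =
     (THE e. \<exists>S T es. smith_transform G S T es \<and> es \<noteq> [] \<and> e = last es)"

definition zq_vecs :: "int \<Rightarrow> nat \<Rightarrow> int vec set" where
  "zq_vecs q m = {x \<in> carrier_vec m. \<forall>i<m. x $ i \<in> carrier (residue_ring q)}"

definition H_col :: "int mat \<Rightarrow> int \<Rightarrow> nat \<Rightarrow> int vec set" where
  "H_col C q j =
     {x \<in> zq_vecs q (dim_row C).
        (\<Oplus>\<^bsub>residue_ring q\<^esub> i\<in>{..<dim_row C}. x $ i \<otimes>\<^bsub>residue_ring q\<^esub> (C $$ (i, j) mod q))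
          = \<zero>\<^bsub>residue_ring q\<^esub>}"

definition H_set :: "int mat \<Rightarrow> int \<Rightarrow> nat set \<Rightarrow> int vec set" where
  "H_set C q J = zq_vecs q (dim_row C) \<inter> (\<Inter>j\<in>J. H_col C q j)"

abbreviation col_submatrix :: "int mat \<Rightarrow> nat set \<Rightarrow> int mat" where
  "col_submatrix C J \<equiv> submatrix C UNIV J"

definition rho0 :: "int mat \<Rightarrow> int" where
  "rho0 C = Lcm {largest_elementary_divisor (col_submatrix C J) | J.
     J \<subseteq> {..<dim_col C} \<and> 1 \<le> card J \<and> card J \<le> min (dim_row C) (dim_col C)}"

definition max_abs_entry :: "int mat \<Rightarrow> int mat \<Rightarrow> int" where
  "max_abs_entry A B = Max (abs ` (elements_mat A \<union> elements_mat B))"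

text \<open>The set of admissible \<open>S\<close> is infinite in general, so \<open>Min\<close> is not applicable and the
  minimum is taken as a least element.\<close>

definition min_height :: "int mat \<Rightarrow> nat set \<Rightarrow> int" where
  "min_height C J = (LEAST h. \<exists>S T es.
     smith_transform (col_submatrix C J) S T es \<and> h = max_abs_entry (S * C) C)"

definition q0 :: "int mat \<Rightarrow> int" where
  "q0 C = Max {min_height C J | J. J \<noteq> {} \<and> J \<subseteq> {..<dim_col C}}"

end

theory Submission
  imports Defs
begin

text \<open>Let \<open>L\<close> be the lattice spanned by the columns of \<open>C\<close> indexed by \<open>J\<close>, let \<open>S\<close> bring \<open>C\<^sub>J\<close> to Smith normal
  form with elementary divisors \<open>e\<^sub>1, \<dots>, e\<^sub>l\<close>, and put \<open>u = S c\<^sub>j\<close>. A vector \<open>v\<close> lies in \<open>L\<close> iff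
  \<open>e\<^sub>i\<close> divides \<open>(S v)\<^sub>i\<close> for \<open>i \<le> l\<close> and \<open>(S v)\<^sub>i = 0\<close> for \<open>i > l\<close>. The inclusion of \<open>H\<^sub>J\<close> in \<open>H\<^sub>j\<close> modulo \<open>q\<close>
  says that every \<open>x\<close> annihilating \<open>L\<close> modulo \<open>q\<close> annihilates \<open>c\<^sub>j\<close>, which amounts to
  \<open>gcd e\<^sub>i q dvd u\<^sub>i\<close> for \<open>i \<le> l\<close> and \<open>q dvd u\<^sub>i\<close> for \<open>i > l\<close>. If \<open>S\<close> attains the minimum in the definition
  of \<open>q\<^sub>0\<close> and \<open>q > q\<^sub>0\<close>, the latter just means \<open>u\<^sub>i = 0\<close>; and since \<open>e\<^sub>i\<close> divides \<open>\<rho>\<^sub>0\<close>, the former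
  depends only on \<open>gcd \<rho>\<^sub>0 q\<close>.\<close>

section \<open>Existence of the Smith normal form\<close>

lemma unimodular_carrier: "unimodular n U \<Longrightarrow> U \<in> carrier_mat n n"
  by (simp add: unimodular_def)

lemma unimodular_one: "unimodular n (1\<^sub>m n)"
  by (simp add: unimodular_def)

lemma unimodular_mult: "unimodular n U \<Longrightarrow> unimodular n V \<Longrightarrow> unimodular n (U * V)"
  by (auto simp: unimodular_def det_mult abs_mult)

text \<open>Since \<open>det U\<close> is 1 or -1, it is its own inverse, so the adjugate scaled by
  \<open>det U\<close> is an integral inverse.\<close>

lemma unimodular_inverse:
  assumes "unimodular n U"
  obtains V where "V \<in> carrier_mat n n" "U * V = 1\<^sub>m n" "V * U = 1\<^sub>m n"
proof -
  have U: "U \<in> carrier_mat n n" and "\<bar>det U\<bar> = 1"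
    using assms by (auto simp: unimodular_def)
  then have sq: "det U * det U = 1"
    by (metis abs_mult_self_eq mult_1)
  note adj = adj_mat[OF U]
  have "det U \<cdot>\<^sub>m (det U \<cdot>\<^sub>m 1\<^sub>m n) = 1\<^sub>m n"
    by (auto intro!: eq_matI simp: sq)
  then have "U * (det U \<cdot>\<^sub>m adj_mat U) = 1\<^sub>m n" "(det U \<cdot>\<^sub>m adj_mat U) * U = 1\<^sub>m n"
    using mult_smult_distrib[OF U adj(1)] mult_smult_assoc_mat[OF adj(1) U] adj by auto
  then show ?thesis
    using that[of "det U \<cdot>\<^sub>m adj_mat U"] adj by auto
qed

text \<open>With \<open>U\<close> the identity, such a matrix adds multiples of the first row to the
  others; with \<open>X\<close> zero, it extends a transformation of a smaller block by a fixed
  first coordinate.\<close>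

lemma unimodular_four_block_lower:
  assumes "X \<in> carrier_mat n 1" "unimodular n U"
  shows "unimodular (Suc n) (four_block_mat (1\<^sub>m 1) (0\<^sub>m 1 n) X U)"
proof -
  have "det (four_block_mat (1\<^sub>m 1) (0\<^sub>m 1 n) X U) = det (1\<^sub>m 1 :: int mat) * det U"
    by (rule det_four_block_mat_upper_right_zero) (use assms in \<open>auto simp: unimodular_def\<close>)
  with assms show ?thesis
    by (auto simp: unimodular_def)
qed

lemma unimodular_four_block_upper:
  assumes "X \<in> carrier_mat 1 n" "unimodular n U"
  shows "unimodular (Suc n) (four_block_mat (1\<^sub>m 1) X (0\<^sub>m n 1) U)"
proof -
  have "det (four_block_mat (1\<^sub>m 1) X (0\<^sub>m n 1) U) = det (1\<^sub>m 1 :: int mat) * det U"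
    by (rule det_four_block_mat_lower_left_zero) (use assms in \<open>auto simp: unimodular_def\<close>)
  with assms show ?thesis
    by (auto simp: unimodular_def)
qed

section \<open>Equivalence under integral row and column operations\<close>

text \<open>Hiding \<open>S\<close> and \<open>T\<close> lets single operations be chained by
  transitivity.\<close>

definition unimodular_equiv :: "nat \<Rightarrow> nat \<Rightarrow> int mat \<Rightarrow> int mat \<Rightarrow> bool" where
  "unimodular_equiv m k A B \<longleftrightarrow> A \<in> carrier_mat m k \<and>
     (\<exists>S T. unimodular m S \<and> unimodular k T \<and> B = S * A * T)"

lemma unimodular_equivI:
  "A \<in> carrier_mat m k \<Longrightarrow> unimodular m S \<Longrightarrow> unimodular k T \<Longrightarrow> B = S * A * T \<Longrightarrow>
   unimodular_equiv m k A B"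
  by (auto simp: unimodular_equiv_def)

lemma unimodular_equiv_carrier:
  assumes "unimodular_equiv m k A B"
  shows "A \<in> carrier_mat m k" "B \<in> carrier_mat m k"
  using assms by (auto simp: unimodular_equiv_def unimodular_def)

lemma unimodular_equiv_trans [trans]:
  assumes "unimodular_equiv m k A B" "unimodular_equiv m k B C"
  shows "unimodular_equiv m k A C"
proof -
  obtain S T S' T' where
    1: "unimodular m S" "unimodular k T" "B = S * A * T" "A \<in> carrier_mat m k" and
    2: "unimodular m S'" "unimodular k T'" "C = S' * B * T'"
    using assms by (auto simp: unimodular_equiv_def)
  note c = 1(1,2)[THEN unimodular_carrier] 2(1,2)[THEN unimodular_carrier] 1(4)
  have "S' * (S * A * T) = S' * S * A * T"
    using assoc_mult_mat[OF c(3,1,5)] assoc_mult_mat[OF c(3) mult_carrier_mat[OF c(1,5)] c(2)]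
    by simp
  then have "C = S' * S * A * T * T'"
    by (simp add: 1 2)
  also have "\<dots> = (S' * S) * A * (T * T')"
    by (rule assoc_mult_mat[of _ m k _ k _ k]) (use c in auto)
  finally show ?thesis
    by (rule unimodular_equivI[OF 1(4) unimodular_mult[OF 2(1) 1(1)] unimodular_mult[OF 1(2) 2(2)]])
qed

lemma unimodular_equiv_rowI:
  assumes "A \<in> carrier_mat m k" "unimodular m S" "B = S * A"
  shows "unimodular_equiv m k A B"
  by (rule unimodular_equivI[OF assms(1,2) unimodular_one])
    (use assms unimodular_carrier[OF assms(2)] in simp)

lemma unimodular_equiv_colI:
  assumes "A \<in> carrier_mat m k" "unimodular k T" "B = A * T"
  shows "unimodular_equiv m k A B"
  by (rule unimodular_equivI[OF assms(1) unimodular_one assms(2)]) (use assms in simp)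

lemma unimodular_equiv_refl: "A \<in> carrier_mat m k \<Longrightarrow> unimodular_equiv m k A A"
  by (rule unimodular_equiv_rowI[of _ _ _ "1\<^sub>m m"]) (auto simp: unimodular_one)

lemma unimodular_equiv_addrow:
  "A \<in> carrier_mat m k \<Longrightarrow> i < m \<Longrightarrow> l < m \<Longrightarrow> i \<noteq> l \<Longrightarrow> unimodular_equiv m k A (addrow a i l A)"
  by (rule unimodular_equiv_rowI[of _ _ _ "addrow_mat m a i l"])
    (auto simp: unimodular_def det_addrow_mat addrow_mat)

lemma unimodular_equiv_addcol:
  "A \<in> carrier_mat m k \<Longrightarrow> i < k \<Longrightarrow> l < k \<Longrightarrow> i \<noteq> l \<Longrightarrow> unimodular_equiv m k A (addcol a i l A)"
  by (rule unimodular_equiv_colI[of _ _ _ "addrow_mat k a l i"])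
    (auto simp: unimodular_def det_addrow_mat addcol_mat)

text \<open>The case \<open>i = l\<close> is kept because a pivot may already sit in the first row
  or column; the swap is then the identity, of determinant 1 instead of -1.\<close>

lemma unimodular_swaprows_mat:
  assumes "i < n" "l < n"
  shows "unimodular n (swaprows_mat n i l)"
proof (cases "i = l")
  case True
  then have "swaprows_mat n i l = (1\<^sub>m n :: int mat)"
    by (intro eq_matI) auto
  then show ?thesis
    by (simp add: unimodular_one)
qed (use assms in \<open>simp add: unimodular_def det_swaprows_mat\<close>)

lemma unimodular_equiv_swaprows:
  "A \<in> carrier_mat m k \<Longrightarrow> i < m \<Longrightarrow> l < m \<Longrightarrow> unimodular_equiv m k A (swaprows i l A)"
  by (rule unimodular_equiv_rowI[OF _ unimodular_swaprows_mat]) (auto simp: swaprows_mat)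

lemma unimodular_equiv_swapcols:
  "A \<in> carrier_mat m k \<Longrightarrow> i < k \<Longrightarrow> l < k \<Longrightarrow> unimodular_equiv m k A (swapcols i l A)"
  by (rule unimodular_equiv_colI[OF _ unimodular_swaprows_mat]) (auto simp: swapcols_mat)

lemma unimodular_equiv_negrow:
  "A \<in> carrier_mat m k \<Longrightarrow> i < m \<Longrightarrow> unimodular_equiv m k A (multrow i (- 1) A)"
  by (rule unimodular_equiv_rowI[of _ _ _ "multrow_mat m i (- 1)"])
    (auto simp: unimodular_def det_multrow_mat multrow_mat)

section \<open>Reduction to Smith normal form\<close>

text \<open>The first row and column consist of multiples of the corner, so one block multiplication
  from each side clears them.\<close>

lemma unimodular_equiv_clear_cross:
  assumes A: "A \<in> carrier_mat (Suc m) (Suc k)"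
    and col: "\<And>i. i < Suc m \<Longrightarrow> A $$ (0, 0) dvd A $$ (i, 0)"
    and row: "\<And>j. j < Suc k \<Longrightarrow> A $$ (0, 0) dvd A $$ (0, j)"
  obtains E where "E \<in> carrier_mat m k"
    "unimodular_equiv (Suc m) (Suc k) A
       (four_block_mat (mat 1 1 (\<lambda>_. A $$ (0, 0))) (0\<^sub>m 1 k) (0\<^sub>m m 1) E)"
proof -
  define d where "d = A $$ (0, 0)"
  define R where "R = mat 1 k (\<lambda>(_, j). A $$ (0, Suc j))"
  define L where "L = mat m 1 (\<lambda>(i, _). A $$ (Suc i, 0))"
  define R' where "R' = mat 1 k (\<lambda>(_, j). - (A $$ (0, Suc j) div d))"
  define L' where "L' = mat m 1 (\<lambda>(i, _). - (A $$ (Suc i, 0) div d))"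
  define D where "D = mat 1 1 (\<lambda>_. d)"
  define F where "F = mat m k (\<lambda>(i, j). A $$ (Suc i, Suc j))"
  \<comment> \<open>This is the Schur complement of the corner: what the lower right block becomes
    when the column below the corner is cleared. Clearing the first row afterwards leaves it
    unchanged.\<close>
  define E where "E = L' * R + F"
  have c [simp]: "R \<in> carrier_mat 1 k" "L \<in> carrier_mat m 1" "R' \<in> carrier_mat 1 k"
    "L' \<in> carrier_mat m 1" "D \<in> carrier_mat 1 1" "F \<in> carrier_mat m k" "E \<in> carrier_mat m k"
    by (auto simp: R_def L_def R'_def L'_def D_def F_def E_def)
  have A_eq: "A = four_block_mat D R L F"
    using A by (intro eq_matI) (auto simp: D_def R_def L_def F_def d_def)
  have L0: "L' * D + L = 0\<^sub>m m 1"
    using col by (intro eq_matI)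
      (auto simp: L'_def D_def L_def d_def scalar_prod_def)
  have R0: "D * R' + R = 0\<^sub>m 1 k"
    using row by (intro eq_matI)
      (auto simp: R'_def D_def R_def d_def scalar_prod_def)
  define S where "S = four_block_mat (1\<^sub>m 1) (0\<^sub>m 1 m) L' (1\<^sub>m m)"
  define T where "T = four_block_mat (1\<^sub>m 1) R' (0\<^sub>m k 1) (1\<^sub>m k)"
  have uni: "unimodular (Suc m) S" "unimodular (Suc k) T"
    unfolding S_def T_def
    by (rule unimodular_four_block_lower unimodular_four_block_upper unimodular_one c)+
  have SA: "S * A = four_block_mat (1\<^sub>m 1 * D + 0\<^sub>m 1 m * L) (1\<^sub>m 1 * R + 0\<^sub>m 1 m * F)
      (L' * D + 1\<^sub>m m * L) (L' * R + 1\<^sub>m m * F)"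
    unfolding S_def A_eq by (rule mult_four_block_mat) (rule c one_carrier_mat zero_carrier_mat)+
  have b1: "1\<^sub>m 1 * D + 0\<^sub>m 1 m * L = D" "1\<^sub>m 1 * R + 0\<^sub>m 1 m * F = R"
    using left_mult_one_mat[OF c(5)] left_mult_one_mat[OF c(1)] left_mult_zero_mat[OF c(2)]
      left_mult_zero_mat[OF c(6)] right_add_zero_mat[OF c(5)] right_add_zero_mat[OF c(1)]
    by simp_all
  have b2: "L' * D + 1\<^sub>m m * L = 0\<^sub>m m 1" "L' * R + 1\<^sub>m m * F = E"
    using left_mult_one_mat[OF c(2)] left_mult_one_mat[OF c(6)] L0 by (simp_all add: E_def)
  have S: "S * A = four_block_mat D R (0\<^sub>m m 1) E"
    by (simp only: SA b1 b2)
  have ET: "four_block_mat D R (0\<^sub>m m 1) E * T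
      = four_block_mat (D * 1\<^sub>m 1 + R * 0\<^sub>m k 1) (D * R' + R * 1\<^sub>m k)
          (0\<^sub>m m 1 * 1\<^sub>m 1 + E * 0\<^sub>m k 1) (0\<^sub>m m 1 * R' + E * 1\<^sub>m k)"
    unfolding T_def by (rule mult_four_block_mat) (rule c one_carrier_mat zero_carrier_mat)+
  have b3: "D * 1\<^sub>m 1 + R * 0\<^sub>m k 1 = D" "D * R' + R * 1\<^sub>m k = 0\<^sub>m 1 k"
    using right_mult_one_mat[OF c(5)] right_mult_one_mat[OF c(1)] right_mult_zero_mat[OF c(1)]
      right_add_zero_mat[OF c(5)] R0 by simp_all
  have b4: "0\<^sub>m m 1 * 1\<^sub>m 1 + E * 0\<^sub>m k 1 = 0\<^sub>m m 1" "0\<^sub>m m 1 * R' + E * 1\<^sub>m k = E"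
    using right_mult_one_mat[OF c(7)] right_mult_zero_mat[OF c(7)] left_mult_zero_mat[OF c(3)]
      left_add_zero_mat[OF c(7)] right_mult_one_mat[of "0\<^sub>m m 1 :: int mat" m 1] by simp_all
  have T: "four_block_mat D R (0\<^sub>m m 1) E * T = four_block_mat D (0\<^sub>m 1 k) (0\<^sub>m m 1) E"
    by (simp only: ET b3 b4)
  have "unimodular_equiv (Suc m) (Suc k) A (four_block_mat D (0\<^sub>m 1 k) (0\<^sub>m m 1) E)"
    by (rule unimodular_equivI[OF A uni]) (simp only: S T)
  then show ?thesis
    using that[OF c(7)] by (simp only: D_def d_def)
qed


text \<open>Together with its mirror image below, this carries divisibility by the pivot from the
  remaining block to the Smith form of that block.\<close>

lemma dvd_mult_mat_left:
  fixes d :: int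
  assumes "X \<in> carrier_mat a b" "Y \<in> carrier_mat b c"
    and "\<And>i j. i < b \<Longrightarrow> j < c \<Longrightarrow> d dvd Y $$ (i, j)" and "i < a" "j < c"
  shows "d dvd (X * Y) $$ (i, j)"
  using assms by (auto simp: scalar_prod_def intro!: dvd_sum dvd_mult)

lemma dvd_mult_mat_right:
  fixes d :: int
  assumes "X \<in> carrier_mat a b" "Y \<in> carrier_mat b c"
    and "\<And>i j. i < a \<Longrightarrow> j < b \<Longrightarrow> d dvd X $$ (i, j)" and "i < a" "j < c"
  shows "d dvd (X * Y) $$ (i, j)"
  using assms by (auto simp: scalar_prod_def intro!: dvd_sum dvd_mult2)

text \<open>Bordering \<open>S\<close> and \<open>T\<close> with a 1 in the corner leaves
  \<open>D\<close> alone, so the reduction can continue inside the smaller block.\<close>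

lemma unimodular_equiv_four_block:
  assumes "unimodular_equiv m k E E'" and D: "D \<in> carrier_mat 1 1"
  shows "unimodular_equiv (Suc m) (Suc k)
    (four_block_mat D (0\<^sub>m 1 k) (0\<^sub>m m 1) E) (four_block_mat D (0\<^sub>m 1 k) (0\<^sub>m m 1) E')"
proof -
  obtain S T where ST: "unimodular m S" "unimodular k T" "E' = S * E * T" and E: "E \<in> carrier_mat m k"
    using assms by (auto simp: unimodular_equiv_def)
  note c = unimodular_carrier[OF ST(1)] unimodular_carrier[OF ST(2)] D E
    one_carrier_mat zero_carrier_mat
  have SE: "S * E \<in> carrier_mat m k"
    using c by simp
  define S1 where "S1 = four_block_mat (1\<^sub>m 1) (0\<^sub>m 1 m) (0\<^sub>m m 1) S"
  define T1 where "T1 = four_block_mat (1\<^sub>m 1) (0\<^sub>m 1 k) (0\<^sub>m k 1) T"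
  have uni: "unimodular (Suc m) S1" "unimodular (Suc k) T1"
    unfolding S1_def T1_def
    by (rule unimodular_four_block_lower ST zero_carrier_mat)+
  have S: "S1 * four_block_mat D (0\<^sub>m 1 k) (0\<^sub>m m 1) E
      = four_block_mat (1\<^sub>m 1 * D + 0\<^sub>m 1 m * 0\<^sub>m m 1) (1\<^sub>m 1 * 0\<^sub>m 1 k + 0\<^sub>m 1 m * E)
          (0\<^sub>m m 1 * D + S * 0\<^sub>m m 1) (0\<^sub>m m 1 * 0\<^sub>m 1 k + S * E)"
    unfolding S1_def by (rule mult_four_block_mat) (rule c)+
  have T: "four_block_mat D (0\<^sub>m 1 k) (0\<^sub>m m 1) (S * E) * T1
      = four_block_mat (D * 1\<^sub>m 1 + 0\<^sub>m 1 k * 0\<^sub>m k 1) (D * 0\<^sub>m 1 k + 0\<^sub>m 1 k * T)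
          (0\<^sub>m m 1 * 1\<^sub>m 1 + (S * E) * 0\<^sub>m k 1) (0\<^sub>m m 1 * 0\<^sub>m 1 k + (S * E) * T)"
    unfolding T1_def by (rule mult_four_block_mat) (rule c SE)+
  have S': "S1 * four_block_mat D (0\<^sub>m 1 k) (0\<^sub>m m 1) E
      = four_block_mat D (0\<^sub>m 1 k) (0\<^sub>m m 1) (S * E)"
    unfolding S by (rule arg_cong4[of _ _ _ _ _ _ _ _ four_block_mat])
      (use c SE in \<open>auto intro!: eq_matI\<close>)
  have T': "four_block_mat D (0\<^sub>m 1 k) (0\<^sub>m m 1) (S * E) * T1
      = four_block_mat D (0\<^sub>m 1 k) (0\<^sub>m m 1) E'"
    unfolding T ST(3) by (rule arg_cong4[of _ _ _ _ _ _ _ _ four_block_mat])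
      (use c SE in \<open>auto intro!: eq_matI\<close>)
  show ?thesis
    by (rule unimodular_equivI[OF _ uni]) (use c S' T' in auto)
qed

text \<open>One round of the reduction. That \<open>d\<close> divides all of \<open>E\<close> is
  what later makes the diagonal a divisibility chain.\<close>

lemma smith_pivot:
  assumes A: "A \<in> carrier_mat (Suc m) (Suc k)" and "A \<noteq> 0\<^sub>m (Suc m) (Suc k)"
  obtains d E where "d > 0" "E \<in> carrier_mat m k"
    "unimodular_equiv (Suc m) (Suc k) A
       (four_block_mat (mat 1 1 (\<lambda>_. d)) (0\<^sub>m 1 k) (0\<^sub>m m 1) E)"
    "\<And>i j. i < m \<Longrightarrow> j < k \<Longrightarrow> d dvd E $$ (i, j)"
proof -
  let ?eq = "unimodular_equiv (Suc m) (Suc k)"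
  define P where "P r \<longleftrightarrow> r > 0 \<and>
    (\<exists>B i j. ?eq A B \<and> i < Suc m \<and> j < Suc k \<and> B $$ (i, j) = int r)" for r
  \<comment> \<open>The pivot is the least positive entry among all equivalent matrices: a nonzero remainder
    modulo it would be a smaller one.\<close>
  obtain i0 j0 where ij0: "i0 < Suc m" "j0 < Suc k" "A $$ (i0, j0) \<noteq> 0"
    using assms by (metis carrier_matD eq_matI index_zero_mat)
  have "\<exists>r. P r"
  proof (cases "A $$ (i0, j0) > 0")
    case True
    then have "P (nat (A $$ (i0, j0)))"
      unfolding P_def using ij0 unimodular_equiv_refl[OF A] by auto
    then show ?thesis ..
  next
    case False
    then have "P (nat (- (A $$ (i0, j0))))"
      unfolding P_def using ij0 A unimodular_equiv_negrow[OF A ij0(1)]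
      by (intro conjI exI[of _ "multrow i0 (- 1) A"] exI[of _ i0] exI[of _ j0]) auto
    then show ?thesis ..
  qed
  define r where "r = (LEAST r. P r)"
  define d where "d = int r"
  have "P r"
    unfolding r_def using \<open>\<exists>r. P r\<close> by (rule LeastI_ex)
  then obtain B i j where B: "?eq A B" "i < Suc m" "j < Suc k" "B $$ (i, j) = d" and d: "d > 0"
    by (auto simp: P_def d_def)
  have minimal: "d \<le> B $$ (i, j)"
    if "?eq A B" "i < Suc m" "j < Suc k" "B $$ (i, j) > 0" for B i j
  proof -
    have "P (nat (B $$ (i, j)))"
      unfolding P_def using that by auto
    then show ?thesis
      unfolding d_def r_def using Least_le[of P] that(4) by fastforce
  qed
  have dvd_if: "d dvd x" if "x mod d > 0 \<Longrightarrow> d \<le> x mod d" for x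
    using that pos_mod_bound[OF d, of x] pos_mod_sign[OF d, of x]
    unfolding dvd_eq_mod_eq_0 by linarith
  have col_dvd: "d dvd B $$ (i, 0)" if B: "?eq A B" "B $$ (0, 0) = d" and i: "i < Suc m" for B i
  proof (cases "i = 0")
    case False
    note Bc = unimodular_equiv_carrier(2)[OF B(1)]
    \<comment> \<open>Subtracting the right multiple of the pivot row leaves the remainder modulo
      \<open>d\<close> in column 0; by minimality it is not positive, hence 0.\<close>
    let ?B = "addrow (- (B $$ (i, 0) div d)) i 0 B"
    have "?eq A ?B"
      using B(1) unimodular_equiv_addrow[OF Bc i _ False] by (rule unimodular_equiv_trans) simp
    moreover have "?B $$ (i, 0) = B $$ (i, 0) mod d"
      using Bc i B(2) by (simp add: minus_div_mult_eq_mod[symmetric])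
    ultimately show ?thesis
      using minimal[of ?B i 0] i by (intro dvd_if) simp
  qed (use B in simp)
  \<comment> \<open>Stated for every equivalent matrix with \<open>d\<close> in the corner, because
    it serves twice: for \<open>B0\<close>, and for the matrices \<open>?G\<close> that expose the
    entries of \<open>E\<close>.\<close>
  have row_dvd: "d dvd B $$ (0, j)" if B: "?eq A B" "B $$ (0, 0) = d" and j: "j < Suc k" for B j
  proof (cases "j = 0")
    case False
    note Bc = unimodular_equiv_carrier(2)[OF B(1)]
    let ?B = "addcol (- (B $$ (0, j) div d)) j 0 B"
    have "?eq A ?B"
      using B(1) unimodular_equiv_addcol[OF Bc j _ False] by (rule unimodular_equiv_trans) simp
    moreover have "?B $$ (0, j) = B $$ (0, j) mod d"
      using Bc j B(2) by (simp add: minus_div_mult_eq_mod[symmetric])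
    ultimately show ?thesis
      using minimal[of ?B 0 j] j by (intro dvd_if) simp
  qed (use B in simp)
  define B0 where "B0 = swapcols 0 j (swaprows 0 i B)"
  note Bc = unimodular_equiv_carrier(2)[OF B(1)]
  have "?eq B (swaprows 0 i B)"
    using unimodular_equiv_swaprows[OF Bc _ B(2)] by simp
  also have "?eq (swaprows 0 i B) B0"
    unfolding B0_def using Bc B(3) by (intro unimodular_equiv_swapcols) auto
  finally have B0: "?eq A B0"
    using B(1) unimodular_equiv_trans by blast
  have B00: "B0 $$ (0, 0) = d"
    using Bc B(2-4) by (simp add: B0_def)
  obtain E where E: "E \<in> carrier_mat m k" and "?eq B0
       (four_block_mat (mat 1 1 (\<lambda>_. B0 $$ (0, 0))) (0\<^sub>m 1 k) (0\<^sub>m m 1) E)"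
    by (rule unimodular_equiv_clear_cross[OF unimodular_equiv_carrier(2)[OF B0]])
       (use col_dvd[OF B0 B00] row_dvd[OF B0 B00] B00 in auto)
  moreover define F where "F = four_block_mat (mat 1 1 (\<lambda>_. d)) (0\<^sub>m 1 k) (0\<^sub>m m 1) E"
  ultimately have F: "?eq A F"
    using unimodular_equiv_trans[OF B0] B00 by simp
  have "d dvd E $$ (i, j)" if "i < m" "j < k" for i j
  proof -
    note Fc = unimodular_equiv_carrier(2)[OF F]
    \<comment> \<open>Adding a lower row to the first keeps \<open>d\<close> in the corner, since
      \<open>F\<close> is zero below it, and copies a row of \<open>E\<close> into the first row,
      where \<open>row_dvd\<close> applies.\<close>
    let ?G = "addrow 1 0 (Suc i) F"
    have "?eq A ?G"
      using F unimodular_equiv_addrow[OF Fc _ _ , of 0 "Suc i" 1]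
      by (rule unimodular_equiv_trans) (use that in auto)
    moreover have "?G $$ (0, 0) = d" "?G $$ (0, Suc j) = E $$ (i, j)"
      using Fc E that by (auto simp: F_def)
    ultimately show ?thesis
      using row_dvd[of ?G "Suc j"] that by simp
  qed
  then show ?thesis
    using that[OF d E] F by (simp add: F_def)
qed

text \<open>Induction on the number of rows, splitting off one pivot \<open>d\<close> at a time. The
  Smith form of the remaining block has entries that are integer combinations of those of
  \<open>E\<close>, so \<open>d\<close> divides them all and \<open>d # es\<close> is again a
  chain.\<close>

lemma smith_form_exists:
  assumes "A \<in> carrier_mat m k"
  shows "\<exists>es. length es \<le> min m k \<and> (\<forall>e\<in>set es. 0 < e) \<and> sorted_wrt (dvd) es \<and>
    unimodular_equiv m k A (smith_form_mat m k es)"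
  using assms
proof (induction m arbitrary: k A)
  case 0
  then have "smith_form_mat 0 k [] = A"
    by (intro eq_matI) (auto simp: smith_form_mat_def)
  with 0 show ?case
    by (intro exI[of _ "[]"]) (auto simp: unimodular_equiv_refl)
next
  case (Suc m)
  show ?case
  proof (cases "A = 0\<^sub>m (Suc m) k")
    case True
    then have "smith_form_mat (Suc m) k [] = A"
      by (intro eq_matI) (auto simp: smith_form_mat_def)
    with Suc.prems show ?thesis
      by (intro exI[of _ "[]"]) (auto simp: unimodular_equiv_refl)
  next
    case False
    then have "k \<noteq> 0"
      using Suc.prems by (auto intro: eq_matI)
    then obtain k' where k: "k = Suc k'"
      using not0_implies_Suc by blast
    obtain d E where d: "d > 0" and E: "E \<in> carrier_mat m k'" and
      AF: "unimodular_equiv (Suc m) (Suc k') A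
        (four_block_mat (mat 1 1 (\<lambda>_. d)) (0\<^sub>m 1 k') (0\<^sub>m m 1) E)" and
      dvd: "\<And>i j. i < m \<Longrightarrow> j < k' \<Longrightarrow> d dvd E $$ (i, j)"
      using smith_pivot[of A m k'] Suc.prems False k by metis
    obtain es where es: "length es \<le> min m k'" "\<forall>e\<in>set es. 0 < e" "sorted_wrt (dvd) es" and
      EE: "unimodular_equiv m k' E (smith_form_mat m k' es)"
      using Suc.IH[OF E] by blast
    obtain S T where ST: "unimodular m S" "unimodular k' T" "smith_form_mat m k' es = S * E * T"
      using EE by (auto simp: unimodular_equiv_def)
    note c = unimodular_carrier[OF ST(1)] unimodular_carrier[OF ST(2)]
    have "d dvd e" if e: "e \<in> set es" for e
    proof -
      obtain i where i: "i < length es" "es ! i = e"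
        using e by (auto simp: in_set_conv_nth)
      then have "e = (S * E * T) $$ (i, i)"
        unfolding ST(3)[symmetric] using es(1) by (simp add: smith_form_mat_def)
      moreover have "d dvd (S * E * T) $$ (i, i)"
        by (rule dvd_mult_mat_right[OF mult_carrier_mat[OF c(1) E] c(2) dvd_mult_mat_left[OF c(1) E dvd]])
          (use i(1) es(1) c E in auto)
      ultimately show ?thesis
        by simp
    qed
    moreover have "four_block_mat (mat 1 1 (\<lambda>_. d)) (0\<^sub>m 1 k') (0\<^sub>m m 1) (smith_form_mat m k' es)
        = smith_form_mat (Suc m) (Suc k') (d # es)"
      by (intro eq_matI) (auto simp: smith_form_mat_def nth_Cons' )
    then have "unimodular_equiv (Suc m) (Suc k') A (smith_form_mat (Suc m) (Suc k') (d # es))"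
      using AF unimodular_equiv_four_block[OF EE, of "mat 1 1 (\<lambda>_. d)"] unimodular_equiv_trans
      by (metis mat_carrier)
    ultimately show ?thesis
      using es d k by (intro exI[of _ "d # es"]) auto
  qed
qed

lemma smith_transform_exists: "\<exists>S T es. smith_transform G S T es"
  using smith_form_exists[of G "dim_row G" "dim_col G"]
  by (fastforce simp: smith_transform_def unimodular_equiv_def)


section \<open>The lattice spanned by a set of columns\<close>

text \<open>Coefficients are indexed by the original column numbers, not by positions in the
  submatrix, so that lattices for different \<open>J\<close> can be compared directly.\<close>

definition column_lattice :: "int mat \<Rightarrow> nat set \<Rightarrow> int vec set" where
  "column_lattice C J = range (\<lambda>a. vec (dim_row C) (\<lambda>i. \<Sum>j\<in>J. a j * C $$ (i, j)))"

lemma column_lattice_carrier: "v \<in> column_lattice C J \<Longrightarrow> v \<in> carrier_vec (dim_row C)"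
  by (auto simp: column_lattice_def)

lemma column_latticeI:
  "v = vec (dim_row C) (\<lambda>i. \<Sum>j\<in>J. a j * C $$ (i, j)) \<Longrightarrow> v \<in> column_lattice C J"
  unfolding column_lattice_def by blast

lemma col_in_column_lattice:
  assumes "finite J" "j \<in> J" "j < dim_col C"
  shows "col C j \<in> column_lattice C J"
  using assms
  by (intro column_latticeI[where a = "\<lambda>l. if l = j then 1 else 0"] eq_vecI)
    (auto simp: if_distrib[of "\<lambda>x. x * _"] sum.delta cong: if_cong)

lemma column_lattice_mono:
  assumes "J' \<subseteq> J" "finite J"
  shows "column_lattice C J' \<subseteq> column_lattice C J"
proof
  fix v assume "v \<in> column_lattice C J'"
  then obtain a where v: "v = vec (dim_row C) (\<lambda>i. \<Sum>j\<in>J'. a j * C $$ (i, j))"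
    by (auto simp: column_lattice_def)
  have "(\<Sum>j\<in>J'. a j * C $$ (i, j)) = (\<Sum>j\<in>J. (if j \<in> J' then a j else 0) * C $$ (i, j))" for i
    using assms by (intro sum.mono_neutral_cong_left) auto
  then show "v \<in> column_lattice C J"
    unfolding v column_lattice_def by simp
qed

text \<open>By linearity of the scalar product. It replaces conditions on single columns by one on
  the lattice, where a change of basis is possible.\<close>

lemma scalar_prod_column_lattice_dvd_iff:
  assumes C: "C \<in> carrier_mat m n" and J: "J \<subseteq> {..<n}" and x: "x \<in> carrier_vec m"
  shows "(\<forall>v\<in>column_lattice C J. q dvd x \<bullet> v) \<longleftrightarrow> (\<forall>j\<in>J. q dvd x \<bullet> col C j)"
proof
  have "finite J"
    using J finite_subset by blast
  then show "\<forall>j\<in>J. q dvd x \<bullet> col C j" if "\<forall>v\<in>column_lattice C J. q dvd x \<bullet> v"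
    using that J C by (auto intro!: col_in_column_lattice)
  show "\<forall>v\<in>column_lattice C J. q dvd x \<bullet> v" if cols: "\<forall>j\<in>J. q dvd x \<bullet> col C j"
  proof
    fix v assume "v \<in> column_lattice C J"
    then obtain a where v: "v = vec m (\<lambda>i. \<Sum>j\<in>J. a j * C $$ (i, j))"
      using C by (auto simp: column_lattice_def)
    have "x \<bullet> v = (\<Sum>i<m. \<Sum>j\<in>J. a j * (x $ i * C $$ (i, j)))"
      using C by (auto simp: v scalar_prod_def sum_distrib_left atLeast0LessThan algebra_simps
          intro!: sum.cong)
    also have "\<dots> = (\<Sum>j\<in>J. a j * (\<Sum>i<m. x $ i * C $$ (i, j)))"
      by (subst sum.swap) (simp add: sum_distrib_left)
    also have "\<dots> = (\<Sum>j\<in>J. a j * (x \<bullet> col C j))"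
      using C J by (intro sum.cong) (auto simp: scalar_prod_def atLeast0LessThan)
    also have "q dvd \<dots>"
      using cols by (auto intro!: dvd_sum)
    finally show "q dvd x \<bullet> v" .
  qed
qed

section \<open>The lattice as the image of the column submatrix\<close>

lemma col_submatrix_carrier:
  assumes "C \<in> carrier_mat m n" "J \<subseteq> {..<n}"
  shows "col_submatrix C J \<in> carrier_mat m (card J)"
proof -
  have "{j. j < n \<and> j \<in> J} = J"
    using assms by auto
  then show ?thesis
    using assms by (auto simp: dim_submatrix)
qed

lemma col_submatrix_index:
  assumes "C \<in> carrier_mat m n" "J \<subseteq> {..<n}" "i < m" "l < card J"
  shows "col_submatrix C J $$ (i, l) = C $$ (i, pick J l)"
proof -
  have "{j. j < n \<and> j \<in> J} = J"
    using assms by auto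
  then show ?thesis
    using assms by (subst submatrix_index) (auto simp: pick_UNIV)
qed

text \<open>Translates between positions in the submatrix and column numbers of
  \<open>C\<close>.\<close>

lemma bij_betw_pick: "finite J \<Longrightarrow> bij_betw (pick J) {..<card J} J"
proof (rule bij_betw_imageI)
  assume J: "finite J"
  show inj: "inj_on (pick J) {..<card J}"
    by (rule linorder_inj_onI') (use pick_mono_le in fastforce)
  show "pick J ` {..<card J} = J"
    using card_image[OF inj] J by (intro card_subset_eq) (auto simp: pick_in_set_le)
qed

lemma mult_col_submatrix:
  assumes "C \<in> carrier_mat m n" "J \<subseteq> {..<n}"
  shows "col_submatrix C J *\<^sub>v vec (card J) (\<lambda>l. a (pick J l))
    = vec m (\<lambda>i. \<Sum>j\<in>J. a j * C $$ (i, j))"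
proof (rule eq_vecI)
  note G = col_submatrix_carrier[OF assms]
  have J: "finite J"
    using assms finite_subset by blast
  fix i assume "i < dim_vec (vec m (\<lambda>i. \<Sum>j\<in>J. a j * C $$ (i, j)))"
  then have i: "i < m" by simp
  have "(\<Sum>l<card J. a (pick J l) * C $$ (i, pick J l)) = (\<Sum>j\<in>J. a j * C $$ (i, j))"
    by (rule sum.reindex_bij_betw[OF bij_betw_pick[OF J]])
  then show "(col_submatrix C J *\<^sub>v vec (card J) (\<lambda>l. a (pick J l))) $ i
      = vec m (\<lambda>i. \<Sum>j\<in>J. a j * C $$ (i, j)) $ i"
    using i G by (simp add: scalar_prod_def col_submatrix_index[OF assms] atLeast0LessThan mult.commute)
qed (use col_submatrix_carrier[OF assms] in auto)

lemma vec_eq_pick: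
  assumes "finite J" "w \<in> carrier_vec (card J)"
  obtains a where "w = vec (card J) (\<lambda>l. a (pick J l))"
proof
  show "w = vec (card J) (\<lambda>l. (\<lambda>j. w $ the_inv_into {..<card J} (pick J) j) (pick J l))"
    using assms bij_betw_pick[OF assms(1)]
    by (intro eq_vecI) (auto simp: bij_betw_def the_inv_into_f_f)
qed

lemma column_lattice_eq_image:
  assumes "C \<in> carrier_mat m n" "J \<subseteq> {..<n}"
  shows "column_lattice C J = (\<lambda>w. col_submatrix C J *\<^sub>v w) ` carrier_vec (card J)" (is "_ = ?R")
proof (intro equalityI subsetI)
  fix v assume "v \<in> column_lattice C J"
  then obtain a where "v = vec m (\<lambda>i. \<Sum>j\<in>J. a j * C $$ (i, j))"
    using assms by (auto simp: column_lattice_def)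
  then show "v \<in> ?R"
    using mult_col_submatrix[OF assms, of a] by (metis imageI vec_carrier)
next
  fix v assume "v \<in> ?R"
  then obtain w where w: "w \<in> carrier_vec (card J)" "v = col_submatrix C J *\<^sub>v w"
    by blast
  have "finite J"
    using assms finite_subset by blast
  then obtain a where "w = vec (card J) (\<lambda>l. a (pick J l))"
    using w vec_eq_pick by metis
  then have "v = vec m (\<lambda>i. \<Sum>j\<in>J. a j * C $$ (i, j))"
    using w mult_col_submatrix[OF assms] by simp
  then show "v \<in> column_lattice C J"
    using assms by (auto simp: column_lattice_def)
qed

section \<open>The lattice in Smith coordinates\<close>

lemma smith_form_mult_vec:
  assumes "z \<in> carrier_vec k" "length es \<le> min m k"
  shows "smith_form_mat m k es *\<^sub>v z = vec m (\<lambda>i. if i < length es then es ! i * z $ i else 0)"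
proof (rule eq_vecI)
  fix i assume "i < dim_vec (vec m (\<lambda>i. if i < length es then es ! i * z $ i else 0))"
  then have i: "i < m" by simp
  have "(smith_form_mat m k es *\<^sub>v z) $ i
      = (\<Sum>j<k. if i = j then if i < length es then es ! i * z $ i else 0 else 0)"
    using i assms unfolding smith_form_mat_def
    by (auto simp: scalar_prod_def atLeast0LessThan if_distrib[of "\<lambda>x. x * _"] sum.delta'
        cong: if_cong)
  then show "(smith_form_mat m k es *\<^sub>v z) $ i
      = vec m (\<lambda>i. if i < length es then es ! i * z $ i else 0) $ i"
    using i assms by (auto simp: sum.delta')
qed (simp add: smith_form_mat_def)

lemma smith_transformD:
  assumes "smith_transform G S T es" "G \<in> carrier_mat m k"
  shows "S \<in> carrier_mat m m" "T \<in> carrier_mat k k" "unimodular m S" "unimodular k T"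
    "length es \<le> min m k" "S * G * T = smith_form_mat m k es"
    "\<And>i. i < length es \<Longrightarrow> 0 < es ! i"
    "\<And>i. i < length es \<Longrightarrow> es ! i dvd last es"
proof -
  show "S \<in> carrier_mat m m" "T \<in> carrier_mat k k" "unimodular m S" "unimodular k T"
    "length es \<le> min m k" "S * G * T = smith_form_mat m k es"
    "\<And>i. i < length es \<Longrightarrow> 0 < es ! i"
    using assms by (auto simp: smith_transform_def unimodular_def)
  fix i assume i: "i < length es"
  then have "es ! i dvd es ! (length es - 1)"
    using assms by (cases "i = length es - 1") (auto simp: smith_transform_def sorted_wrt_iff_nth_less)
  with i show "es ! i dvd last es"
    by (subst last_conv_nth) auto
qed

text \<open>Every lattice vector is \<open>G *\<^sub>v (T *\<^sub>v z)\<close> with \<open>z\<close>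
  integral, because \<open>T\<close> is invertible over the integers; \<open>S\<close> maps it to
  the Smith form applied to \<open>z\<close>, whose coordinates are arbitrary multiples of the
  \<open>es ! i\<close>, followed by zeros.\<close>

lemma mem_column_lattice_iff:
  assumes C: "C \<in> carrier_mat m n" and J: "J \<subseteq> {..<n}"
    and smith: "smith_transform (col_submatrix C J) S T es" and v: "v \<in> carrier_vec m"
  shows "v \<in> column_lattice C J \<longleftrightarrow>
    (\<forall>i<m. if i < length es then es ! i dvd (S *\<^sub>v v) $ i else (S *\<^sub>v v) $ i = 0)"
proof -
  define G where "G = col_submatrix C J"
  define k where "k = card J"
  have G: "G \<in> carrier_mat m k"
    using col_submatrix_carrier[OF C J] by (simp add: G_def k_def)
  note D = smith_transformD[OF smith[folded G_def] G]
  obtain S' where S': "S' \<in> carrier_mat m m" "S * S' = 1\<^sub>m m" "S' * S = 1\<^sub>m m"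
    using unimodular_inverse[OF D(3)] .
  obtain T' where T': "T' \<in> carrier_mat k k" "T * T' = 1\<^sub>m k" "T' * T = 1\<^sub>m k"
    using unimodular_inverse[OF D(4)] .
  have SGT: "S *\<^sub>v (G *\<^sub>v (T *\<^sub>v z)) = vec m (\<lambda>i. if i < length es then es ! i * z $ i else 0)"
    if z: "z \<in> carrier_vec k" for z
  proof -
    have "S *\<^sub>v (G *\<^sub>v (T *\<^sub>v z)) = S * G * T *\<^sub>v z"
      using D(1,2) G z by (simp add: assoc_mult_mat_vec[of _ m k _ k] assoc_mult_mat_vec[of _ m m _ k])
    then show ?thesis
      using D(5,6) z by (simp add: smith_form_mult_vec)
  qed
  have L: "column_lattice C J = (\<lambda>w. G *\<^sub>v w) ` carrier_vec k"
    using column_lattice_eq_image[OF C J] by (simp add: G_def k_def)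
  show ?thesis
  proof
    assume "v \<in> column_lattice C J"
    then obtain w where w: "w \<in> carrier_vec k" "v = G *\<^sub>v w"
      by (auto simp: L)
    have "T *\<^sub>v (T' *\<^sub>v w) = w"
      using assoc_mult_mat_vec[OF D(2) T'(1) w(1)] T'(2) w(1) by simp
    then have "S *\<^sub>v v = vec m (\<lambda>i. if i < length es then es ! i * (T' *\<^sub>v w) $ i else 0)"
      using SGT[of "T' *\<^sub>v w"] T'(1) w by simp
    then show "\<forall>i<m. if i < length es then es ! i dvd (S *\<^sub>v v) $ i else (S *\<^sub>v v) $ i = 0"
      by simp
  next
    assume *: "\<forall>i<m. if i < length es then es ! i dvd (S *\<^sub>v v) $ i else (S *\<^sub>v v) $ i = 0"
    \<comment> \<open>Only the first \<open>length es\<close> coordinates matter; the values of the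
      others are killed by the zero columns of the Smith form.\<close>
    define z where "z = vec k (\<lambda>i. (S *\<^sub>v v) $ i div es ! i)"
    have z: "z \<in> carrier_vec k"
      by (simp add: z_def)
    have "S *\<^sub>v (G *\<^sub>v (T *\<^sub>v z)) = S *\<^sub>v v"
      unfolding SGT[OF z] using * D(1,5) by (intro eq_vecI) (auto simp: z_def)
    then have "S' *\<^sub>v (S *\<^sub>v (G *\<^sub>v (T *\<^sub>v z))) = S' *\<^sub>v (S *\<^sub>v v)"
      by simp
    then have "G *\<^sub>v (T *\<^sub>v z) = v"
      using assoc_mult_mat_vec[OF S'(1) D(1), symmetric] v z D(2) G S'(3) by simp
    then show "v \<in> column_lattice C J"
      unfolding L using D(2) z by (metis imageI mult_mat_vec_carrier)
  qed
qed

lemma mult_mat_vec_smult: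
  fixes A :: "'a::comm_semiring_0 mat"
  assumes "A \<in> carrier_mat m k" "v \<in> carrier_vec k"
  shows "A *\<^sub>v (r \<cdot>\<^sub>v v) = r \<cdot>\<^sub>v (A *\<^sub>v v)"
  using assms by (intro eq_vecI) (auto simp: scalar_prod_def sum_distrib_left algebra_simps)

section \<open>Torsion exponent and largest elementary divisor\<close>

text \<open>In the coordinates given by \<open>S\<close>, the quotient by the lattice is a sum of
  cyclic groups of orders \<open>es ! i\<close> and a free part. Its torsion is annihilated by
  \<open>e\<close> exactly when the largest order divides \<open>e\<close>. The right-hand side
  mentions no Smith form, which gives uniqueness.\<close>

lemma last_dvd_iff_torsion_exponent:
  assumes C: "C \<in> carrier_mat m n" and J: "J \<subseteq> {..<n}"
    and smith: "smith_transform (col_submatrix C J) S T es" and es: "es \<noteq> []"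
  shows "last es dvd e \<longleftrightarrow>
    (\<forall>v\<in>carrier_vec m. \<forall>r. r \<noteq> 0 \<longrightarrow> r \<cdot>\<^sub>v v \<in> column_lattice C J \<longrightarrow> e \<cdot>\<^sub>v v \<in> column_lattice C J)"
proof -
  note D = smith_transformD[OF smith col_submatrix_carrier[OF C J]]
  have mem: "r \<cdot>\<^sub>v v \<in> column_lattice C J \<longleftrightarrow>
      (\<forall>i<m. if i < length es then es ! i dvd r * (S *\<^sub>v v) $ i else r * (S *\<^sub>v v) $ i = 0)"
    if "v \<in> carrier_vec m" for r v
    using that D(1) by (subst mem_column_lattice_iff[OF C J smith])
      (auto simp: mult_mat_vec_smult[OF D(1)])
  show ?thesis
  proof
    assume "last es dvd e"
    then have "es ! i dvd e * x" if "i < length es" for i x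
      using D(8)[OF that] by (meson dvd_mult2 dvd_trans)
    then show "\<forall>v\<in>carrier_vec m. \<forall>r. r \<noteq> 0 \<longrightarrow> r \<cdot>\<^sub>v v \<in> column_lattice C J \<longrightarrow>
        e \<cdot>\<^sub>v v \<in> column_lattice C J"
      by (auto simp: mem)
  next
    assume *: "\<forall>v\<in>carrier_vec m. \<forall>r. r \<noteq> 0 \<longrightarrow> r \<cdot>\<^sub>v v \<in> column_lattice C J \<longrightarrow>
        e \<cdot>\<^sub>v v \<in> column_lattice C J"
    obtain S' where S': "S' \<in> carrier_mat m m" "S * S' = 1\<^sub>m m" "S' * S = 1\<^sub>m m"
      using unimodular_inverse[OF D(3)] .
    define l where "l = length es - 1"
    have l: "l < length es" "last es = es ! l"
      using es by (auto simp: l_def last_conv_nth)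
    have "l < m"
      using l(1) D(5) by linarith
    note l = l this
    \<comment> \<open>The class of this vector modulo the lattice has order exactly
      \<open>es ! l\<close>.\<close>
    define v where "v = S' *\<^sub>v unit_vec m l"
    have v: "v \<in> carrier_vec m"
      using S'(1) by (simp add: v_def)
    have Sv: "S *\<^sub>v v = unit_vec m l"
      unfolding v_def using assoc_mult_mat_vec[OF D(1) S'(1), of "unit_vec m l"] S'(2) by simp
    have "(es ! l) \<cdot>\<^sub>v v \<in> column_lattice C J"
      using l(1,3) by (simp add: mem[OF v] Sv)
    then have "e \<cdot>\<^sub>v v \<in> column_lattice C J"
      using *[rule_format, OF v, of "es ! l"] D(7)[OF l(1)] by simp
    then have "es ! l dvd e * unit_vec m l $ l"
      using l(1,3) unfolding mem[OF v] Sv by presburger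
    then show "last es dvd e"
      using l by simp
  qed
qed

text \<open>The last entries of two Smith forms have the same multiples, by the torsion criterion,
  and both are positive; hence the definite description is well defined.\<close>

lemma largest_elementary_divisor_eq:
  assumes C: "C \<in> carrier_mat m n" and J: "J \<subseteq> {..<n}"
    and smith: "smith_transform (col_submatrix C J) S T es" and es: "es \<noteq> []"
  shows "largest_elementary_divisor (col_submatrix C J) = last es"
  unfolding largest_elementary_divisor_def
proof (rule the_equality)
  show "\<exists>S T es'. smith_transform (col_submatrix C J) S T es' \<and> es' \<noteq> [] \<and> last es = last es'"
    using assms by blast
  fix e assume "\<exists>S T es. smith_transform (col_submatrix C J) S T es \<and> es \<noteq> [] \<and> e = last es"
  then obtain S' T' es' where
    smith': "smith_transform (col_submatrix C J) S' T' es'" "es' \<noteq> []" "e = last es'"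
    by blast
  have "e dvd last es" "last es dvd e"
    using last_dvd_iff_torsion_exponent[OF C J smith es]
      last_dvd_iff_torsion_exponent[OF C J smith'(1,2)] smith'(3) dvd_refl by metis+
  moreover have "0 < e" "0 < last es"
    using smith smith' es by (auto simp: smith_transform_def)
  ultimately show "e = last es"
    by (simp add: zdvd_antisym_nonneg)
qed

text \<open>Without elementary divisors the lattice would be zero, yet it contains the nonzero
  column \<open>j\<close>.\<close>

lemma elementary_divisors_nonempty:
  assumes C: "C \<in> carrier_mat m n" and J: "J \<subseteq> {..<n}"
    and smith: "smith_transform (col_submatrix C J) S T es"
    and j: "j \<in> J" "col C j \<noteq> 0\<^sub>v m"
  shows "es \<noteq> []"
proof
  assume es: "es = []"
  note D = smith_transformD[OF smith col_submatrix_carrier[OF C J]]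
  obtain S' where S': "S' \<in> carrier_mat m m" "S' * S = 1\<^sub>m m"
    using unimodular_inverse[OF D(3)] by metis
  have c: "col C j \<in> carrier_vec m"
    using C by (rule col_carrier_vec[rotated]) (use J j in auto)
  have "col C j \<in> column_lattice C J"
    using C J j finite_subset by (intro col_in_column_lattice) auto
  then have "S *\<^sub>v col C j = 0\<^sub>v m"
    using D(1) es unfolding mem_column_lattice_iff[OF C J smith c] by (intro eq_vecI) auto
  then have "S' *\<^sub>v (S *\<^sub>v col C j) = 0\<^sub>v m"
    using S'(1) by (auto simp: scalar_prod_def)
  then show False
    using assoc_mult_mat_vec[OF S'(1) D(1) c] S'(2) c j by simp
qed


section \<open>Passing to at most \<open>m\<close> columns\<close>

text \<open>With more columns than rows, the Smith form has a zero column.\<close>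

lemma column_dependency:
  fixes C :: "int mat"
  assumes C: "C \<in> carrier_mat m n" and J: "J \<subseteq> {..<n}" and "m < card J"
  obtains a l where "l \<in> J" "a l \<noteq> 0" "\<And>i. i < m \<Longrightarrow> (\<Sum>j\<in>J. a j * C $$ (i, j)) = 0"
proof -
  define k where "k = card J"
  define G where "G = col_submatrix C J"
  have fin: "finite J"
    using J finite_subset by blast
  have G: "G \<in> carrier_mat m k"
    using col_submatrix_carrier[OF C J] by (simp add: G_def k_def)
  obtain S T es where "smith_transform G S T es"
    using smith_transform_exists by blast
  note D = smith_transformD[OF this G]
  obtain S' where S': "S' \<in> carrier_mat m m" "S' * S = 1\<^sub>m m"
    using unimodular_inverse[OF D(3)] by metis
  obtain T' where T': "T' \<in> carrier_mat k k" "T' * T = 1\<^sub>m k"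
    using unimodular_inverse[OF D(4)] by metis
  \<comment> \<open>Counting from 0, \<open>m\<close> is the first column beyond the square part of
    the Smith form, so it is a zero column.\<close>
  define w where "w = T *\<^sub>v unit_vec k m"
  have w: "w \<in> carrier_vec k"
    using D(2) by (simp add: w_def)
  have "S *\<^sub>v (G *\<^sub>v w) = S * G * T *\<^sub>v unit_vec k m"
    using D(1,2) G unfolding w_def
    by (simp add: assoc_mult_mat_vec[of _ m k _ k] assoc_mult_mat_vec[of _ m m _ k])
  also have "\<dots> = 0\<^sub>v m"
    using D(5,6) assms(3) by (auto simp: smith_form_mult_vec k_def intro!: eq_vecI)
  finally have "S' *\<^sub>v (S *\<^sub>v (G *\<^sub>v w)) = 0\<^sub>v m"
    using S'(1) by (auto simp: scalar_prod_def)
  then have Gw: "G *\<^sub>v w = 0\<^sub>v m"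
    using assoc_mult_mat_vec[OF S'(1) D(1), of "G *\<^sub>v w"] S'(2) G w by simp
  have "T' *\<^sub>v w = unit_vec k m"
    unfolding w_def using assoc_mult_mat_vec[OF T'(1) D(2), of "unit_vec k m"] T'(2) by simp
  moreover have "T' *\<^sub>v 0\<^sub>v k = 0\<^sub>v k"
    using T'(1) by (intro eq_vecI) (auto simp: scalar_prod_def)
  ultimately have "w \<noteq> 0\<^sub>v k"
    using assms(3) by (metis index_unit_vec(1) index_zero_vec(1) k_def zero_neq_one)
  then obtain l where l: "l < k" "w $ l \<noteq> 0"
    using w by (metis carrier_vecD eq_vecI index_zero_vec)
  obtain a where a: "w = vec k (\<lambda>l. a (pick J l))"
    using vec_eq_pick[OF fin, of w] w by (auto simp: k_def)
  have sum0: "vec m (\<lambda>i. \<Sum>j\<in>J. a j * C $$ (i, j)) = 0\<^sub>v m"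
    using Gw mult_col_submatrix[OF C J, of a] by (simp add: a G_def k_def)
  have "(\<Sum>j\<in>J. a j * C $$ (i, j)) = 0" if "i < m" for i
    using arg_cong[OF sum0, of "\<lambda>v. v $ i"] that by simp
  moreover have "pick J l \<in> J" "a (pick J l) \<noteq> 0"
    using l fin by (auto simp: a k_def pick_in_set_le)
  ultimately show ?thesis
    using that by blast
qed

text \<open>Scale a combination \<open>b\<close> by \<open>a l\<close> and subtract
  \<open>b l\<close> times the dependency: the coefficient of column \<open>l\<close>
  cancels.\<close>

lemma column_lattice_drop_dependent:
  assumes "finite J" "l \<in> J" "\<And>i. i < dim_row C \<Longrightarrow> (\<Sum>j\<in>J. a j * C $$ (i, j)) = 0"
    and "v \<in> column_lattice C J"
  shows "a l \<cdot>\<^sub>v v \<in> column_lattice C (J - {l})"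
proof -
  obtain b where v: "v = vec (dim_row C) (\<lambda>i. \<Sum>j\<in>J. b j * C $$ (i, j))"
    using assms(4) by (auto simp: column_lattice_def)
  have "a l * (\<Sum>j\<in>J. b j * C $$ (i, j)) = (\<Sum>j\<in>J - {l}. (a l * b j - b l * a j) * C $$ (i, j))"
    if "i < dim_row C" for i
  proof -
    have "a l * (\<Sum>j\<in>J. b j * C $$ (i, j))
        = a l * (\<Sum>j\<in>J. b j * C $$ (i, j)) - b l * (\<Sum>j\<in>J. a j * C $$ (i, j))"
      using assms(3)[OF that] by simp
    also have "\<dots> = (\<Sum>j\<in>J. (a l * b j - b l * a j) * C $$ (i, j))"
      by (simp add: sum_distrib_left sum_subtractf[symmetric] algebra_simps)
    also have "\<dots> = (\<Sum>j\<in>J - {l}. (a l * b j - b l * a j) * C $$ (i, j))"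
      using assms(1,2) by (simp add: sum.remove)
    finally show ?thesis .
  qed
  then show ?thesis
    unfolding v by (intro column_latticeI[where a = "\<lambda>j. a l * b j - b l * a j"] eq_vecI) auto
qed

text \<open>Among the subsets whose lattice contains a nonzero multiple of the whole lattice, take
  one of least size. If it had more than \<open>m\<close> columns, a dependency would allow dropping
  one more.\<close>

lemma full_rank_subset:
  assumes C: "C \<in> carrier_mat m n" and J: "J \<subseteq> {..<n}"
  obtains J' r where "J' \<subseteq> J" "card J' \<le> m" "r \<noteq> 0"
    "\<And>v. v \<in> column_lattice C J \<Longrightarrow> r \<cdot>\<^sub>v v \<in> column_lattice C J'"
proof -
  define P where "P K \<longleftrightarrow> K \<subseteq> J \<and>
    (\<exists>r. r \<noteq> 0 \<and> (\<forall>v\<in>column_lattice C J. r \<cdot>\<^sub>v v \<in> column_lattice C K))" for K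
  have "P J"
    by (auto simp: P_def intro!: exI[of _ 1])
  then obtain K where K: "P K" and minimal: "\<And>K'. P K' \<Longrightarrow> card K \<le> card K'"
    using ex_has_least_nat[of P J card] by blast
  obtain r where r: "r \<noteq> 0" "\<And>v. v \<in> column_lattice C J \<Longrightarrow> r \<cdot>\<^sub>v v \<in> column_lattice C K"
    and KJ: "K \<subseteq> J"
    using K by (auto simp: P_def)
  have fin: "finite K"
    using KJ J finite_subset by (metis finite_lessThan)
  have "card K \<le> m"
  proof (rule ccontr)
    assume "\<not> card K \<le> m"
    then obtain a l where al: "l \<in> K" "a l \<noteq> 0"
      "\<And>i. i < m \<Longrightarrow> (\<Sum>j\<in>K. a j * C $$ (i, j)) = 0"
      using column_dependency[OF C, of K] KJ J by (metis not_le order_trans)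
    have "(a l * r) \<cdot>\<^sub>v v \<in> column_lattice C (K - {l})" if "v \<in> column_lattice C J" for v
      using column_lattice_drop_dependent[OF fin al(1) _ r(2)[OF that], of a] al(3) C
      by (simp add: smult_smult_assoc)
    then have "P (K - {l})"
      using KJ r al by (auto simp: P_def intro!: exI[of _ "a l * r"])
    then have "card K \<le> card (K - {l})"
      by (rule minimal)
    then show False
      using card_Diff1_less[OF fin al(1)] by simp
  qed
  then show ?thesis
    using that KJ r by blast
qed

text \<open>For a full-rank subset \<open>J'\<close> of \<open>J\<close>, the torsion of \<open>\<int>\<^sup>m\<close> modulo the lattice of \<open>J\<close> is a quotient of
  the torsion modulo the lattice of \<open>J'\<close>; so \<open>e(J)\<close> divides \<open>e(J')\<close> and the size restriction in the
  definition of \<open>\<rho>\<^sub>0\<close> is harmless.\<close>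

lemma largest_elementary_divisor_dvd_rho0:
  assumes C: "C \<in> carrier_mat m n" and nz: "\<And>i. i < n \<Longrightarrow> col C i \<noteq> 0\<^sub>v m"
    and J: "J \<noteq> {}" "J \<subseteq> {..<n}"
  shows "largest_elementary_divisor (col_submatrix C J) dvd rho0 C"
proof -
  obtain J' r where J': "J' \<subseteq> J" "card J' \<le> m" and r: "r \<noteq> 0"
    "\<And>v. v \<in> column_lattice C J \<Longrightarrow> r \<cdot>\<^sub>v v \<in> column_lattice C J'"
    using full_rank_subset[OF C J(2)] by metis
  obtain j where j: "j \<in> J"
    using J by blast
  have fin: "finite J"
    using J finite_subset by blast
  have J'n: "J' \<subseteq> {..<n}"
    using J J' by blast
  \<comment> \<open>Otherwise a nonzero multiple of a nonzero column would be zero.\<close>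
  have "J' \<noteq> {}"
  proof
    assume "J' = {}"
    have "col C j \<in> column_lattice C J"
      using C J fin j by (intro col_in_column_lattice) auto
    then have "r \<cdot>\<^sub>v col C j = 0\<^sub>v m"
      using r(2) \<open>J' = {}\<close> C by (auto simp: column_lattice_def zero_vec_def)
    then have "col C j = 0\<^sub>v m"
      using r(1) C by (intro eq_vecI) (auto simp: vec_eq_iff)
    then show False
      using nz j J by auto
  qed
  then obtain j' where j': "j' \<in> J'"
    by blast
  obtain S T es where s: "smith_transform (col_submatrix C J) S T es"
    using smith_transform_exists by blast
  obtain S' T' es' where s': "smith_transform (col_submatrix C J') S' T' es'"
    using smith_transform_exists by blast
  have es: "es \<noteq> []"
    using elementary_divisors_nonempty[OF C J(2) s j] nz j J by auto
  have es': "es' \<noteq> []"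
    using elementary_divisors_nonempty[OF C J'n s' j'] nz j' J'n by auto
  \<comment> \<open>If \<open>k\<close> carries \<open>v\<close> into the lattice of
    \<open>J\<close>, then the nonzero number \<open>r * k\<close> carries it into that of
    \<open>J'\<close>, so the torsion criterion for \<open>J'\<close> applies.\<close>
  have "last es' \<cdot>\<^sub>v v \<in> column_lattice C J"
    if v: "v \<in> carrier_vec m" "k \<noteq> 0" "k \<cdot>\<^sub>v v \<in> column_lattice C J" for v k
  proof -
    have "(r * k) \<cdot>\<^sub>v v \<in> column_lattice C J'"
      using r(2)[OF v(3)] by (simp add: smult_smult_assoc)
    then have "last es' \<cdot>\<^sub>v v \<in> column_lattice C J'"
      using last_dvd_iff_torsion_exponent[OF C J'n s' es', of "last es'"] v r(1)
      by (metis dvd_refl mult_eq_0_iff)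
    then show ?thesis
      using column_lattice_mono[OF J'(1) fin] by blast
  qed
  then have "last es dvd last es'"
    using last_dvd_iff_torsion_exponent[OF C J(2) s es] by blast
  moreover have "1 \<le> card J'" "card J' \<le> n"
    using \<open>J' \<noteq> {}\<close> J'n finite_subset card_mono[of "{..<n}" J']
    by (auto simp: Suc_le_eq card_gt_0_iff)
  then have "largest_elementary_divisor (col_submatrix C J') dvd rho0 C"
    unfolding rho0_def using C J'(2) J'n by (intro dvd_Lcm) auto
  ultimately show ?thesis
    using largest_elementary_divisor_eq[OF C J(2) s es] largest_elementary_divisor_eq[OF C J'n s' es']
    by (metis dvd_trans)
qed

section \<open>Annihilators modulo \<open>q\<close>\<close>

text \<open>Let \<open>y\<close> be the coordinates of \<open>x\<close> dual to \<open>S\<close>.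
  Annihilating the lattice means that \<open>q\<close> divides \<open>es ! i * y $ i\<close> for
  \<open>i < length es\<close>, with no condition on the other \<open>y $ i\<close>, while
  \<open>x \<bullet> c\<close> is the sum of the \<open>y $ i * (S *\<^sub>v c) $ i\<close>. So the
  coordinates can be tested separately.\<close>

lemma annihilator_subset_iff:
  assumes C: "C \<in> carrier_mat m n" and J: "J \<subseteq> {..<n}"
    and smith: "smith_transform (col_submatrix C J) S T es"
    and c: "c \<in> carrier_vec m" and q: "q > 0"
  shows "(\<forall>x\<in>carrier_vec m. (\<forall>v\<in>column_lattice C J. q dvd x \<bullet> v) \<longrightarrow> q dvd x \<bullet> c) \<longleftrightarrow>
    (\<forall>i<m. if i < length es then gcd (es ! i) q dvd (S *\<^sub>v c) $ i else q dvd (S *\<^sub>v c) $ i)"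
    (is "?L \<longleftrightarrow> ?R")
proof -
  note D = smith_transformD[OF smith col_submatrix_carrier[OF C J]]
  note mem = mem_column_lattice_iff[OF C J smith]
  \<comment> \<open>The admissible values of the \<open>i\<close>-th dual coordinate are exactly the
    multiples of \<open>q div g i\<close>.\<close>
  define g where "g i = (if i < length es then gcd (es ! i) q else q)" for i
  have g: "g i dvd q" for i
    by (simp add: g_def)
  have R: "?R \<longleftrightarrow> (\<forall>i<m. g i dvd (S *\<^sub>v c) $ i)"
    by (auto simp: g_def)
  show ?thesis
    unfolding R
  proof
    assume L: ?L
    show "\<forall>i<m. g i dvd (S *\<^sub>v c) $ i"
    proof (intro allI impI)
      fix i assume i: "i < m"
      obtain f where f: "q = g i * f"
        using g by (metis dvdE)
      \<comment> \<open>The annihilator whose only nonzero dual coordinate is the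
        \<open>i\<close>-th, with value \<open>f\<close>, that is, \<open>q div g i\<close>.\<close>
      define x where "x = f \<cdot>\<^sub>v row S i"
      have x: "x \<in> carrier_vec m"
        using D(1) i by (auto simp: x_def)
      have xv: "x \<bullet> v = f * (S *\<^sub>v v) $ i" if "v \<in> carrier_vec m" for v
        using that D(1) i by (simp add: x_def)
      have "q dvd x \<bullet> v" if "v \<in> column_lattice C J" for v
      proof -
        have v: "v \<in> carrier_vec m"
          using column_lattice_carrier[OF that] C by simp
        then have "g i dvd (S *\<^sub>v v) $ i"
          using mem[OF v] that i by (auto simp: g_def intro: dvd_trans)
        then show ?thesis
          unfolding xv[OF v] by (subst f) (simp add: mult.commute)
      qed
      then have "q dvd f * (S *\<^sub>v c) $ i"
        using L x xv[OF c] by metis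
      then have "f * g i dvd f * (S *\<^sub>v c) $ i"
        using f by (simp add: mult.commute)
      then show "g i dvd (S *\<^sub>v c) $ i"
        using f q by (cases "f = 0") auto
    qed
  next
    assume R: "\<forall>i<m. g i dvd (S *\<^sub>v c) $ i"
    show ?L
    proof (intro ballI impI)
      fix x assume x: "x \<in> carrier_vec m" and ann: "\<forall>v\<in>column_lattice C J. q dvd x \<bullet> v"
      obtain S' where S': "S' \<in> carrier_mat m m" "S * S' = 1\<^sub>m m" "S' * S = 1\<^sub>m m"
        using unimodular_inverse[OF D(3)] .
      define y where "y = transpose_mat S' *\<^sub>v x"
      have y: "y \<in> carrier_vec m"
        unfolding y_def using S'(1) x by (intro mult_mat_vec_carrier[of _ m m]) auto
      have yx: "x \<bullet> (S' *\<^sub>v u) = y \<bullet> u" if "u \<in> carrier_vec m" for u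
        unfolding y_def using transpose_vec_mult_scalar[OF S'(1) that x] by simp
      have "q dvd y $ i * (S *\<^sub>v c) $ i" if i: "i < m" for i
      proof (cases "i < length es")
        case True
        \<comment> \<open>A lattice vector that isolates the dual coordinate
          \<open>y $ i\<close>.\<close>
        define v where "v = S' *\<^sub>v (es ! i \<cdot>\<^sub>v unit_vec m i)"
        have v: "v \<in> carrier_vec m"
          using S'(1) by (simp add: v_def)
        have "S *\<^sub>v v = es ! i \<cdot>\<^sub>v unit_vec m i"
          unfolding v_def using assoc_mult_mat_vec[OF D(1) S'(1), of "es ! i \<cdot>\<^sub>v unit_vec m i"] S'(2)
          by simp
        then have "v \<in> column_lattice C J"
          using True i by (auto simp: mem[OF v])
        then have "q dvd x \<bullet> v"
          using ann by blast
        also have "x \<bullet> v = es ! i * y $ i"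
          unfolding v_def using yx[of "es ! i \<cdot>\<^sub>v unit_vec m i"] y i
          by (simp add: scalar_prod_right_unit)
        finally have ey: "q dvd es ! i * y $ i" .
        \<comment> \<open>Bezout: \<open>q\<close> divides both \<open>es ! i * y $ i\<close> and
          \<open>q * y $ i\<close>, hence also \<open>gcd (es ! i) q * y $ i\<close>.\<close>
        obtain a b where "a * es ! i + b * q = gcd (es ! i) q"
          using bezout_int by blast
        then have "gcd (es ! i) q * y $ i = (a * es ! i + b * q) * y $ i"
          by simp
        also have "\<dots> = a * (es ! i * y $ i) + q * (b * y $ i)"
          by (simp add: algebra_simps)
        finally have "q dvd gcd (es ! i) q * y $ i"
          using ey by simp
        also have "\<dots> dvd (S *\<^sub>v c) $ i * y $ i"
          using R i True by (auto simp: g_def intro!: mult_dvd_mono)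
        finally show ?thesis
          by (simp add: mult.commute)
      next
        case False
        then show ?thesis
          using R i by (auto simp: g_def)
      qed
      then have "q dvd y \<bullet> (S *\<^sub>v c)"
        using D(1) by (auto simp: scalar_prod_def intro!: dvd_sum)
      also have "y \<bullet> (S *\<^sub>v c) = x \<bullet> (S' *\<^sub>v (S *\<^sub>v c))"
        using yx D(1) c by simp
      also have "S' *\<^sub>v (S *\<^sub>v c) = c"
        using assoc_mult_mat_vec[OF S'(1) D(1) c] S'(3) c by simp
      finally show "q dvd x \<bullet> c" .
    qed
  qed
qed

section \<open>From residue vectors to integer vectors\<close>

lemma finsum_residue_ring:
  assumes q: "q > 1" and "finite A" "\<And>i. i \<in> A \<Longrightarrow> f i \<in> carrier (residue_ring q)"
  shows "(\<Oplus>\<^bsub>residue_ring q\<^esub> i\<in>A. f i) = (\<Sum>i\<in>A. f i) mod q"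
proof -
  interpret R: residues q "residue_ring q"
    by unfold_locales (use q in auto)
  interpret R: cring "residue_ring q"
    by (rule R.cring)
  show ?thesis
    using assms(2,3)
  proof (induction A rule: finite_induct)
    case empty
    then show ?case
      by (simp add: R.res_zero_eq)
  next
    case (insert i A)
    then have "(\<Oplus>\<^bsub>residue_ring q\<^esub> i\<in>insert i A. f i)
        = f i \<oplus>\<^bsub>residue_ring q\<^esub> (\<Oplus>\<^bsub>residue_ring q\<^esub> i\<in>A. f i)"
      by (intro R.finsum_insert) auto
    with insert show ?case
      by (simp add: R.res_add_eq mod_add_right_eq)
  qed
qed

lemma mem_H_col_iff:
  assumes C: "C \<in> carrier_mat m n" and j: "j < n" and q: "q > 1" and x: "x \<in> zq_vecs q m"
  shows "x \<in> H_col C q j \<longleftrightarrow> q dvd x \<bullet> col C j"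
proof -
  have "(\<Oplus>\<^bsub>residue_ring q\<^esub> i\<in>{..<m}. x $ i \<otimes>\<^bsub>residue_ring q\<^esub> (C $$ (i, j) mod q))
      = (\<Sum>i<m. x $ i \<otimes>\<^bsub>residue_ring q\<^esub> (C $$ (i, j) mod q)) mod q"
    using q by (intro finsum_residue_ring) (auto simp: residue_ring_def)
  also have "\<dots> = (\<Sum>i<m. x $ i * C $$ (i, j)) mod q"
    by (simp add: residue_ring_def mod_mult_right_eq mod_sum_eq)
  also have "\<dots> = (x \<bullet> col C j) mod q"
    using C j by (simp add: scalar_prod_def atLeast0LessThan)
  finally show ?thesis
    using C x by (simp add: H_col_def dvd_eq_mod_eq_0 residue_ring_def)
qed

text \<open>Reducing the coordinates of \<open>x\<close> modulo \<open>q\<close> does not affect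
  divisibility of its scalar products by \<open>q\<close>, so \<open>x\<close> may range over all
  integer vectors.\<close>

lemma H_set_subset_H_col_iff:
  assumes C: "C \<in> carrier_mat m n" and J: "J \<subseteq> {..<n}" and j: "j < n" and q: "q > 1"
  shows "H_set C q J \<subseteq> H_col C q j \<longleftrightarrow>
    (\<forall>x\<in>carrier_vec m. (\<forall>v\<in>column_lattice C J. q dvd x \<bullet> v) \<longrightarrow> q dvd x \<bullet> col C j)"
proof -
  have H_set: "x \<in> H_set C q J \<longleftrightarrow> x \<in> zq_vecs q m \<and> (\<forall>k\<in>J. q dvd x \<bullet> col C k)" for x
    using mem_H_col_iff[OF C _ q, of _ x] C J by (auto simp: H_set_def subset_eq)
  have "H_set C q J \<subseteq> H_col C q j \<longleftrightarrow>
      (\<forall>x\<in>zq_vecs q m. (\<forall>k\<in>J. q dvd x \<bullet> col C k) \<longrightarrow> q dvd x \<bullet> col C j)"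
    using mem_H_col_iff[OF C j q] H_set by blast
  also have "\<dots> \<longleftrightarrow> (\<forall>x\<in>carrier_vec m. (\<forall>k\<in>J. q dvd x \<bullet> col C k) \<longrightarrow> q dvd x \<bullet> col C j)"
  proof (intro iffI ballI)
    fix x :: "int vec"
    assume *: "\<forall>x\<in>zq_vecs q m. (\<forall>k\<in>J. q dvd x \<bullet> col C k) \<longrightarrow> q dvd x \<bullet> col C j"
      and x: "x \<in> carrier_vec m"
    define x' where "x' = vec m (\<lambda>i. x $ i mod q)"
    have "x' \<in> zq_vecs q m"
      using q by (auto simp: x'_def zq_vecs_def residue_ring_def)
    moreover have "(x' \<bullet> col C k) mod q = (x \<bullet> col C k) mod q" if "k < n" for k
    proof -
      have "(\<Sum>i<m. (x $ i mod q) * C $$ (i, k)) mod q = (\<Sum>i<m. x $ i * C $$ (i, k)) mod q"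
        by (subst (1 2) mod_sum_eq[symmetric]) (simp add: mod_mult_left_eq)
      then show ?thesis
        using C that by (simp add: scalar_prod_def x'_def atLeast0LessThan)
    qed
    then have "q dvd x' \<bullet> col C k \<longleftrightarrow> q dvd x \<bullet> col C k" if "k < n" for k
      using that by (simp add: dvd_eq_mod_eq_0)
    ultimately show "(\<forall>k\<in>J. q dvd x \<bullet> col C k) \<longrightarrow> q dvd x \<bullet> col C j"
      using * j J by blast
  qed (auto simp: zq_vecs_def)
  also have "\<dots> \<longleftrightarrow>
      (\<forall>x\<in>carrier_vec m. (\<forall>v\<in>column_lattice C J. q dvd x \<bullet> v) \<longrightarrow> q dvd x \<bullet> col C j)"
    using scalar_prod_column_lattice_dvd_iff[OF C J] by blast
  finally show ?thesis .
qed

section \<open>Heights of Smith transformations\<close>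

lemma abs_entry_le_max_abs_entry:
  assumes "B \<in> carrier_mat m n" "i < m" "j < n"
  shows "\<bar>B $$ (i, j)\<bar> \<le> max_abs_entry B C" "\<bar>B $$ (i, j)\<bar> \<le> max_abs_entry C B"
proof -
  have "\<bar>B $$ (i, j)\<bar> \<in> abs ` elements_mat B"
    using assms by blast
  moreover have "finite (abs ` (elements_mat B \<union> elements_mat C))"
    "finite (abs ` (elements_mat C \<union> elements_mat B))"
    by (simp_all add: elements_mat_def)
  ultimately show "\<bar>B $$ (i, j)\<bar> \<le> max_abs_entry B C" "\<bar>B $$ (i, j)\<bar> \<le> max_abs_entry C B"
    unfolding max_abs_entry_def by (auto intro!: Max_ge simp: image_Un)
qed

text \<open>The integers are not well-ordered; the lower bound 0 moves the search for a least
  element to the natural numbers.\<close>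

lemma LeastI_int_nonneg:
  fixes P :: "int \<Rightarrow> bool"
  assumes "P h" "\<And>h. P h \<Longrightarrow> 0 \<le> h"
  shows "P (LEAST h. P h)"
proof -
  define k where "k = (LEAST k. P (int k))"
  have "P (int (nat h))"
    using assms by simp
  then have "P (int k)"
    unfolding k_def by (rule LeastI)
  moreover have "int k \<le> h'" if "P h'" for h'
    unfolding k_def using Least_le[of "\<lambda>k. P (int k)" "nat h'"] that assms(2)[OF that] by simp
  ultimately show ?thesis
    using Least_equality[of P "int k"] by simp
qed

text \<open>Positive dimensions give \<open>C\<close> an entry, so every height is at least 0 and
  the least one exists.\<close>

lemma min_height_attained:
  assumes C: "C \<in> carrier_mat m n" and "0 < m" "0 < n"
  obtains S T es where "smith_transform (col_submatrix C J) S T es"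
    "min_height C J = max_abs_entry (S * C) C"
proof -
  let ?P = "\<lambda>h. \<exists>S T es. smith_transform (col_submatrix C J) S T es \<and> h = max_abs_entry (S * C) C"
  obtain S T es where "smith_transform (col_submatrix C J) S T es"
    using smith_transform_exists by blast
  then have "?P (max_abs_entry (S * C) C)"
    by blast
  moreover have "0 \<le> h" if "?P h" for h
    using that abs_entry_le_max_abs_entry(2)[OF assms] abs_ge_zero order_trans by blast
  ultimately have "?P (min_height C J)"
    unfolding min_height_def by (rule LeastI_int_nonneg)
  then show ?thesis
    using that by blast
qed

lemma min_height_le_q0:
  assumes "J \<noteq> {}" "J \<subseteq> {..<dim_col C}"
  shows "min_height C J \<le> q0 C"
proof -
  have "{min_height C J |J. J \<noteq> {} \<and> J \<subseteq> {..<dim_col C}}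
      \<subseteq> min_height C ` Pow {..<dim_col C}"
    by blast
  then have "finite {min_height C J |J. J \<noteq> {} \<and> J \<subseteq> {..<dim_col C}}"
    by (rule finite_subset) simp
  then show ?thesis
    unfolding q0_def using assms by (intro Max_ge) auto
qed

theorem theorem3p1:
  fixes m n :: nat and C :: "int mat" and J :: "nat set" and q q' :: int and j :: nat
  assumes "C \<in> carrier_mat m n"
    and "\<And>i. i < n \<Longrightarrow> col C i \<noteq> 0\<^sub>v m"
    and "J \<noteq> {}" and "J \<subseteq> {..<n}"
    and "q > 0" and "q' > 0"
    and "q > q0 C" and "q' > q0 C"
    and "gcd (rho0 C) q = gcd (rho0 C) q'"
    and "j < n"
  shows "H_col C q j \<supseteq> H_set C q J \<longleftrightarrow> H_col C q' j \<supseteq> H_set C q' J"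
proof -
  note C = assms(1) and J = assms(3,4)
  \<comment> \<open>A nonzero entry of column \<open>j\<close> makes both dimensions positive and
    forces \<open>q0 C\<close> to be at least 1, so that the moduli exceed 1.\<close>
  obtain i0 where i0: "i0 < m" "C $$ (i0, j) \<noteq> 0"
    using assms(1,2,10) by (metis carrier_matD dim_col eq_vecI index_col index_zero_vec)
  \<comment> \<open>The choice of \<open>S\<close> depends only on \<open>C\<close> and
    \<open>J\<close>, so the same \<open>S\<close> serves both moduli.\<close>
  obtain S T es where smith: "smith_transform (col_submatrix C J) S T es"
    and height: "min_height C J = max_abs_entry (S * C) C"
    using min_height_attained[OF C, of J] i0 assms(10) by (metis gr_zeroI not_less_zero)
  note D = smith_transformD[OF smith col_submatrix_carrier[OF C J(2)]]
  have le_q0: "max_abs_entry (S * C) C \<le> q0 C"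
    using min_height_le_q0[of J C] J C height by simp
  have q0: "q0 C \<ge> 1"
    using abs_entry_le_max_abs_entry(2)[OF C i0(1) assms(10), of "S * C"] i0(2) le_q0 by linarith
  obtain k where k: "k \<in> J"
    using J by blast
  have es: "es \<noteq> []"
    using elementary_divisors_nonempty[OF C J(2) smith k] assms(2) k J by auto
  have last: "last es dvd rho0 C"
    using largest_elementary_divisor_dvd_rho0[OF C assms(2) J]
      largest_elementary_divisor_eq[OF C J(2) smith es] by simp
  have c: "col C j \<in> carrier_vec m"
    using C assms(10) by auto
  define u where "u = S *\<^sub>v col C j"
  have u_le: "\<bar>u $ i\<bar> \<le> q0 C" if "i < m" for i
  proof -
    have "u $ i = (S * C) $$ (i, j)"
      using that C D(1) assms(10) by (simp add: u_def)
    then show ?thesis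
      using abs_entry_le_max_abs_entry(1)[of "S * C" m n i j C] that C D(1) assms(10) le_q0 by simp
  qed
  have iff: "H_set C p J \<subseteq> H_col C p j \<longleftrightarrow>
      (\<forall>i<m. if i < length es then gcd (es ! i) (gcd (rho0 C) p) dvd u $ i else u $ i = 0)"
    if p: "p > q0 C" for p
  proof -
    \<comment> \<open>Each \<open>es ! i\<close> divides \<open>last es\<close>, hence
      \<open>rho0 C\<close>, so inserting \<open>rho0 C\<close> into the gcd changes
      nothing.\<close>
    have "gcd (es ! i) p = gcd (es ! i) (gcd (rho0 C) p)" if "i < length es" for i
      using dvd_trans[OF D(8)[OF that] last] D(7)[OF that]
      by (metis abs_of_pos gcd.assoc gcd_proj1_iff normalize_int_def)
    \<comment> \<open>A multiple of \<open>p\<close> of absolute value at most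
      \<open>q0 C < p\<close> is zero.\<close>
    moreover have "p dvd u $ i \<longleftrightarrow> u $ i = 0" if "i < m" for i
      using u_le[OF that] p dvd_imp_le_int[of "u $ i" p] q0 by auto
    ultimately show ?thesis
      using p q0 H_set_subset_H_col_iff[OF C J(2) assms(10), of p]
        annihilator_subset_iff[OF C J(2) smith c, of p] by (simp add: u_def cong: if_cong)
  qed
  show ?thesis
    using iff[OF assms(7)] iff[OF assms(8)] assms(9) by simp
qed

end
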